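(* Let $F$ be a two-dimensional lattice with $F\notin\mathfrak{N}_2$. Then $X_1\oplus_F X_2$ is not a Daugavet range for any Banach spaces $X_1$ and $X_2$.
   Context: All Banach spaces are real and different from $\{0\}$. A nonzero continuous linear operator $G:X\to Y$ between Banach spaces is a Daugavet center if every (bounded) rank-1 operator $T:X\to Y$ satisfies $\|G+T\|=\|G\|+\|T\|$. A Banach space $X$ is a Daugavet range if there exist a Banach space $E$ and a Daugavet center $G:E\to X$. A two-dimensional lattice is a space $F=(\mathbb{R}^2,\|\cdot\|)$, where the norm satisfies $\|(1,0)\|=\|(0,1)\|=1$ and $\|(a_1,a_2)\|=\|(|a_1|,|a_2|)\|$ for all $(a_1,a_2)$, ordered coordinatewise. For Banach spaces $X_1,X_2$, $X_1\oplus_F X_2$ is the space of pairs $(x_1,x_2)$, $x_i\in X_i$, with norm $\|(x_1,x_2)\|=\|(\|x_1\|,\|x_2\|)\|_F$. $S_F^+=\{a\in F:\|a\|=1,\ a\ge 0\}$. $\mathfrak{N}_2$ is the class of those two-dimensional lattices $F$ for which $S_F^+$ is a polygon with at most two edges, i.e. a polygonal arc from $(1,0)$ to $(0,1)$ consisting of at most two edges (maximal nondegenerate line segments). *)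

theory Defs
  imports "HOL-Analysis.Analysis"
begin

text \<open>
  The norm of \<open>X\<^sub>1 \<oplus>\<^sub>F X\<^sub>2\<close> depends on the term \<open>F\<close>, so it cannot come from a type-class instance.
  A normed space is therefore given, where needed, by a real vector space type together with an
  explicit norm function on it.
\<close>

definition is_norm :: "('v::real_vector \<Rightarrow> real) \<Rightarrow> bool" where
  "is_norm N \<longleftrightarrow>
     (\<forall>v. N v = 0 \<longleftrightarrow> v = 0) \<and>
     (\<forall>c v. N (c *\<^sub>R v) = \<bar>c\<bar> * N v) \<and>
     (\<forall>v w. N (v + w) \<le> N v + N w)"

definition is_banach_norm :: "('v::real_vector \<Rightarrow> real) \<Rightarrow> bool" where
  "is_banach_norm N \<longleftrightarrow> is_norm N \<and> Metric_space.mcomplete UNIV (\<lambda>v w. N (v - w))"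

definition bounded_operator :: "('x::real_vector \<Rightarrow> real) \<Rightarrow> ('e::real_normed_vector \<Rightarrow> 'x) \<Rightarrow> bool" where
  "bounded_operator N T \<longleftrightarrow> linear T \<and> (\<exists>K. \<forall>e. N (T e) \<le> norm e * K)"

definition operator_norm :: "('x::real_vector \<Rightarrow> real) \<Rightarrow> ('e::real_normed_vector \<Rightarrow> 'x) \<Rightarrow> real" where
  "operator_norm N T = (SUP e. N (T e) / norm e)"

lemma bounded_operator_norm: "bounded_operator norm T \<longleftrightarrow> bounded_linear T"
  by (auto simp: bounded_operator_def bounded_linear_def bounded_linear_axioms_def)

lemma operator_norm_norm: "operator_norm norm T = onorm T"
  by (simp add: operator_norm_def onorm_def)

definition daugavet_center :: "('x::real_vector \<Rightarrow> real) \<Rightarrow> ('e::banach \<Rightarrow> 'x) \<Rightarrow> bool" where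
  "daugavet_center N G \<longleftrightarrow>
     bounded_operator N G \<and> (\<exists>e. G e \<noteq> 0) \<and>
     (\<forall>T. bounded_operator N T \<and> dim (range T) = 1 \<longrightarrow>
        operator_norm N (\<lambda>e. G e + T e) = operator_norm N G + operator_norm N T)"

text \<open>
  HOL cannot quantify existentially over types, so the domain \<open>E\<close> is the type parameter \<open>'e\<close>:
  a Banach space \<open>(X, N)\<close> is a Daugavet range iff this predicate holds for some Banach space \<open>'e\<close>, and it
  is not a Daugavet range iff the predicate fails for every \<open>'e\<close>.  The requirement \<open>E \<noteq> {0}\<close> follows
  from \<open>G \<noteq> 0\<close>.
\<close>

definition daugavet_range :: "'e::banach itself \<Rightarrow> ('x::real_vector \<Rightarrow> real) \<Rightarrow> bool" where
  "daugavet_range E N \<longleftrightarrow> (\<exists>G :: 'e \<Rightarrow> 'x. daugavet_center N G)"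

definition two_dim_lattice :: "(real \<times> real \<Rightarrow> real) \<Rightarrow> bool" where
  "two_dim_lattice F \<longleftrightarrow>
     is_norm F \<and> F (1, 0) = 1 \<and> F (0, 1) = 1 \<and>
     (\<forall>a\<^sub>1 a\<^sub>2. F (a\<^sub>1, a\<^sub>2) = F (\<bar>a\<^sub>1\<bar>, \<bar>a\<^sub>2\<bar>))"

definition lattice_sum_norm ::
    "(real \<times> real \<Rightarrow> real) \<Rightarrow> 'x\<^sub>1::real_normed_vector \<times> 'x\<^sub>2::real_normed_vector \<Rightarrow> real" where
  "lattice_sum_norm F x = F (norm (fst x), norm (snd x))"

definition pos_sphere :: "(real \<times> real \<Rightarrow> real) \<Rightarrow> (real \<times> real) set" where
  "pos_sphere F = {a. F a = 1 \<and> 0 \<le> fst a \<and> 0 \<le> snd a}"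

definition edges :: "(real \<times> real) set \<Rightarrow> (real \<times> real) set set" where
  "edges S = {e. (\<exists>a b. a \<noteq> b \<and> e = closed_segment a b) \<and> e \<subseteq> S \<and>
                 (\<forall>a b. e \<subseteq> closed_segment a b \<and> closed_segment a b \<subseteq> S \<longrightarrow> closed_segment a b = e)}"

text \<open>
  For a two-dimensional lattice, \<open>pos_sphere F\<close> is always an arc from \<open>(1, 0)\<close> to \<open>(0, 1)\<close>, so being
  such a polygonal arc with at most two edges amounts to being covered by its at most two edges.
\<close>

definition \<NN>\<^sub>2 :: "(real \<times> real \<Rightarrow> real) set" where
  "\<NN>\<^sub>2 = {F. two_dim_lattice F \<and> pos_sphere F = \<Union>(edges (pos_sphere F)) \<and>
              finite (edges (pos_sphere F)) \<and> card (edges (pos_sphere F)) \<le> 2}"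

lemma is_norm_nonneg:
  assumes "is_norm N" shows "0 \<le> N v"
proof -
  have "N (v + (-1) *\<^sub>R v) \<le> N v + N ((-1) *\<^sub>R v)" using assms unfolding is_norm_def by blast
  moreover have "N ((-1) *\<^sub>R v) = \<bar>-1\<bar> * N v" using assms unfolding is_norm_def by blast
  moreover have "N (v + (-1) *\<^sub>R v) = 0" using assms unfolding is_norm_def by simp
  ultimately show ?thesis by simp
qed

lemma two_dim_lattice_mono1:
  assumes F: "two_dim_lattice F" and "0 \<le> a" "a \<le> c"
  shows "F (a, b) \<le> F (c, b)"
proof (cases "c = 0")
  case False
  define t where "t = (1 + a / c) / 2"
  have t: "0 \<le> t" "t \<le> 1" using assms False by (auto simp: t_def field_simps)
  have eq: "(a, b) = t *\<^sub>R (c, b) + (1 - t) *\<^sub>R (- c, b)"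
    using False by (simp add: t_def field_simps)
  have m: "F (- c, b) = F (c, b)"
    using F unfolding two_dim_lattice_def by (metis abs_minus_cancel)
  have "F (a, b) \<le> F (t *\<^sub>R (c, b)) + F ((1 - t) *\<^sub>R (- c, b))"
    using F unfolding two_dim_lattice_def is_norm_def eq by blast
  also have "\<dots> = \<bar>t\<bar> * F (c, b) + \<bar>1 - t\<bar> * F (- c, b)"
    using F unfolding two_dim_lattice_def is_norm_def by presburger
  also have "\<dots> = F (c, b)" using t m by (simp add: algebra_simps)
  finally show ?thesis .
qed (use assms in auto)

lemma two_dim_lattice_swap:
  assumes "two_dim_lattice F" shows "two_dim_lattice (\<lambda>a. F (snd a, fst a))"
proof -
  have n: "is_norm F" using assms by (simp add: two_dim_lattice_def)
  have "F (c *\<^sub>R u, c *\<^sub>R v) = \<bar>c\<bar> * F (u, v)" for c u v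
    using n unfolding is_norm_def by (metis scaleR_Pair)
  moreover have "F (u + u', v + v') \<le> F (u, v) + F (u', v')" for u v u' v'
    using n unfolding is_norm_def by (metis add_Pair)
  moreover have "F (u, v) = 0 \<longleftrightarrow> u = 0 \<and> v = 0" for u v
    using n unfolding is_norm_def by (simp add: zero_prod_def)
  ultimately show ?thesis
    using assms by (auto simp: two_dim_lattice_def is_norm_def zero_prod_def)
qed

lemma two_dim_lattice_mono:
  assumes "two_dim_lattice F" "0 \<le> a" "a \<le> c" "0 \<le> b" "b \<le> d"
  shows "F (a, b) \<le> F (c, d)"
  using two_dim_lattice_mono1[OF assms(1-3), of b]
    two_dim_lattice_mono1[OF two_dim_lattice_swap[OF assms(1)] assms(4,5), of c]
  by simp

lemma two_dim_lattice_axes: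
  assumes "two_dim_lattice F" shows "F (a, 0) = \<bar>a\<bar>" "F (0, a) = \<bar>a\<bar>"
proof -
  have "F (a *\<^sub>R (1, 0)) = \<bar>a\<bar> * F (1, 0)" "F (a *\<^sub>R (0, 1)) = \<bar>a\<bar> * F (0, 1)"
    using assms unfolding two_dim_lattice_def is_norm_def by blast+
  then show "F (a, 0) = \<bar>a\<bar>" "F (0, a) = \<bar>a\<bar>" using assms by (auto simp: two_dim_lattice_def)
qed

lemma lattice_sum_norm_bounds:
  assumes "two_dim_lattice F"
  shows "norm (fst x) \<le> lattice_sum_norm F x" "norm (snd x) \<le> lattice_sum_norm F x"
    "lattice_sum_norm F x \<le> norm (fst x) + norm (snd x)"
proof -
  show "norm (fst x) \<le> lattice_sum_norm F x"
    using two_dim_lattice_mono[OF assms, of "norm (fst x)" "norm (fst x)" 0 "norm (snd x)"]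
    by (simp add: lattice_sum_norm_def two_dim_lattice_axes[OF assms])
  show "norm (snd x) \<le> lattice_sum_norm F x"
    using two_dim_lattice_mono[OF assms, of 0 "norm (fst x)" "norm (snd x)" "norm (snd x)"]
    by (simp add: lattice_sum_norm_def two_dim_lattice_axes[OF assms])
  have "F ((norm (fst x), 0) + (0, norm (snd x))) \<le> F (norm (fst x), 0) + F (0, norm (snd x))"
    using assms unfolding two_dim_lattice_def is_norm_def by blast
  then show "lattice_sum_norm F x \<le> norm (fst x) + norm (snd x)"
    by (simp add: lattice_sum_norm_def two_dim_lattice_axes[OF assms])
qed

lemma is_norm_lattice_sum_norm:
  assumes F: "two_dim_lattice F"
  shows "is_norm (lattice_sum_norm F)"
  unfolding is_norm_def
proof (intro conjI allI)
  have n: "is_norm F" using F by (simp add: two_dim_lattice_def)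
  fix v w :: "'a \<times> 'b" and c :: real
  show "(lattice_sum_norm F v = 0) = (v = 0)"
    using n by (cases v) (simp add: lattice_sum_norm_def is_norm_def zero_prod_def)
  have "F (\<bar>c\<bar> *\<^sub>R (norm (fst v), norm (snd v))) = \<bar>\<bar>c\<bar>\<bar> * F (norm (fst v), norm (snd v))"
    using n unfolding is_norm_def by blast
  then show "lattice_sum_norm F (c *\<^sub>R v) = \<bar>c\<bar> * lattice_sum_norm F v"
    by (simp add: lattice_sum_norm_def)
  have "lattice_sum_norm F (v + w) \<le> F (norm (fst v) + norm (fst w), norm (snd v) + norm (snd w))"
    unfolding lattice_sum_norm_def
    by (intro two_dim_lattice_mono[OF F]) (auto simp: norm_triangle_ineq)
  also have "\<dots> = F ((norm (fst v), norm (snd v)) + (norm (fst w), norm (snd w)))" by simp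
  also have "\<dots> \<le> lattice_sum_norm F v + lattice_sum_norm F w"
    using n unfolding is_norm_def lattice_sum_norm_def by blast
  finally show "lattice_sum_norm F (v + w) \<le> lattice_sum_norm F v + lattice_sum_norm F w" .
qed

lemma Metric_space_is_norm:
  assumes "is_norm N" shows "Metric_space UNIV (\<lambda>v w. N (v - w))"
proof
  fix x y z
  show "0 \<le> N (x - y)" using is_norm_nonneg[OF assms] .
  have "N ((-1) *\<^sub>R (x - y)) = \<bar>-1\<bar> * N (x - y)" using assms unfolding is_norm_def by blast
  then show "N (x - y) = N (y - x)" by simp
  show "(N (x - y) = 0) = (x = y)" using assms by (simp add: is_norm_def)
  have "N ((x - y) + (y - z)) \<le> N (x - y) + N (y - z)" using assms unfolding is_norm_def by blast
  then show "N (x - z) \<le> N (x - y) + N (y - z)" by simp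
qed

lemma is_banach_norm_lattice_sum_norm:
  assumes F: "two_dim_lattice F"
  shows "is_banach_norm (lattice_sum_norm F :: 'a::banach \<times> 'b::banach \<Rightarrow> real)"
proof -
  let ?N = "lattice_sum_norm F :: 'a \<times> 'b \<Rightarrow> real"
  note b = lattice_sum_norm_bounds[OF F]
  interpret M: Metric_space UNIV "\<lambda>v w. ?N (v - w)"
    by (rule Metric_space_is_norm[OF is_norm_lattice_sum_norm[OF F]])
  have "\<exists>l. limitin M.mtopology s l sequentially" if C: "M.MCauchy s" for s
  proof -
    have "Cauchy (\<lambda>n. fst (s n))" unfolding Cauchy_def
    proof (intro allI impI)
      fix e :: real assume "e > 0"
      with C obtain n\<^sub>0 where "\<forall>m n. n\<^sub>0 \<le> m \<longrightarrow> n\<^sub>0 \<le> n \<longrightarrow> ?N (s m - s n) < e"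
        unfolding M.MCauchy_def by blast
      then show "\<exists>n\<^sub>0. \<forall>m\<ge>n\<^sub>0. \<forall>n\<ge>n\<^sub>0. dist (fst (s m)) (fst (s n)) < e"
        by (metis b(1) dist_norm fst_diff order_le_less_trans)
    qed
    moreover have "Cauchy (\<lambda>n. snd (s n))" unfolding Cauchy_def
    proof (intro allI impI)
      fix e :: real assume "e > 0"
      with C obtain n\<^sub>0 where "\<forall>m n. n\<^sub>0 \<le> m \<longrightarrow> n\<^sub>0 \<le> n \<longrightarrow> ?N (s m - s n) < e"
        unfolding M.MCauchy_def by blast
      then show "\<exists>n\<^sub>0. \<forall>m\<ge>n\<^sub>0. \<forall>n\<ge>n\<^sub>0. dist (snd (s m)) (snd (s n)) < e"
        by (metis b(2) dist_norm snd_diff order_le_less_trans)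
    qed
    ultimately obtain l\<^sub>1 l\<^sub>2 where l: "(\<lambda>n. fst (s n)) \<longlonglongrightarrow> l\<^sub>1" "(\<lambda>n. snd (s n)) \<longlonglongrightarrow> l\<^sub>2"
      using Cauchy_convergent_iff convergent_def by metis
    have z: "(\<lambda>n. norm (fst (s n) - l\<^sub>1) + norm (snd (s n) - l\<^sub>2)) \<longlonglongrightarrow> 0"
      using tendsto_add[OF tendsto_norm_zero[OF LIM_zero[OF l(1)]] tendsto_norm_zero[OF LIM_zero[OF l(2)]]]
      by simp
    have "(\<lambda>n. ?N (s n - (l\<^sub>1, l\<^sub>2))) \<longlonglongrightarrow> 0"
    proof (rule tendsto_sandwich[OF _ _ tendsto_const z])
      show "\<forall>\<^sub>F n in sequentially. 0 \<le> ?N (s n - (l\<^sub>1, l\<^sub>2))" by simp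
      show "\<forall>\<^sub>F n in sequentially. ?N (s n - (l\<^sub>1, l\<^sub>2)) \<le> norm (fst (s n) - l\<^sub>1) + norm (snd (s n) - l\<^sub>2)"
        using b(3)[of "s _ - (l\<^sub>1, l\<^sub>2)"] by simp
    qed
    then have "limitin M.mtopology s (l\<^sub>1, l\<^sub>2) sequentially"
      unfolding M.limitin_metric_dist_null by simp
    then show ?thesis by blast
  qed
  then show ?thesis
    unfolding is_banach_norm_def M.mcomplete_def
    using is_norm_lattice_sum_norm[OF F] by blast
qed

end

theory Submission
  imports Defs
begin

text \<open>
  Let \<open>G\<close> be a Daugavet center into \<open>X\<^sub>1 \<oplus>\<^sub>F X\<^sub>2\<close>, scaled to norm 1, and let \<open>x\<close>, \<open>x'\<close> be unit vectors.
  The Daugavet equation for a rank-1 operator \<open>f \<otimes> x\<close> gives \<open>e\<close> in any prescribed slice of the unit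
  ball with \<open>\<parallel>G e + x\<parallel>\<close> close to 2; a norming functional \<open>\<phi>\<close> of \<open>G e + x\<close> turns this into a slice
  (that of \<open>\<phi> \<circ> G\<close>) on all of which it holds, and a second application in this slice makes
  \<open>\<parallel>G e + x'\<parallel>\<close> close to 2 as well.  With \<open>x = (x\<^sub>1, 0)\<close> and \<open>x' = (0, x\<^sub>2)\<close>, compactness gives
  \<open>c \<ge> 0\<close> in the unit sphere of \<open>F\<close> with \<open>F (c + (1, 0)) = F (c + (0, 1)) = 2\<close>.  Hence
  the segments from \<open>c\<close> to \<open>(1, 0)\<close> and to \<open>(0, 1)\<close> lie in the sphere, so that they make up the
  whole positive arc.
\<close>

section \<open>Norming functionals\<close>

text \<open>Scaling asks only for an inequality, so infima and tilts are easier to check; equality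
  follows by applying it to \<open>inverse c\<close> as well.\<close>

definition sublinear :: "('a::real_vector \<Rightarrow> real) \<Rightarrow> bool" where
  "sublinear q \<longleftrightarrow> (\<forall>x y. q (x + y) \<le> q x + q y) \<and> (\<forall>c\<ge>0. \<forall>x. q (c *\<^sub>R x) \<le> c * q x)"

lemma sublinear_add: "sublinear q \<Longrightarrow> q (x + y) \<le> q x + q y"
  by (simp add: sublinear_def)

lemma sublinear_scale:
  assumes "sublinear q" "0 \<le> c"
  shows "q (c *\<^sub>R x) = c * q x"
proof (cases "c = 0")
  case True
  have "q (0 *\<^sub>R x) \<le> 0 * q x" using assms(1) unfolding sublinear_def by blast
  then show ?thesis using True sublinear_add[OF assms(1), of 0 0] by simp
next
  case False
  then have "q (inverse c *\<^sub>R (c *\<^sub>R x)) \<le> inverse c * q (c *\<^sub>R x)"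
    using assms unfolding sublinear_def by (meson inverse_nonnegative_iff_nonnegative)
  then have "c * q x \<le> q (c *\<^sub>R x)" using False assms(2) by (simp add: field_simps)
  then show ?thesis using assms unfolding sublinear_def by (meson order_antisym)
qed

lemma sublinear_zero: "sublinear q \<Longrightarrow> q 0 = 0"
  using sublinear_scale[of q 0 0] by simp

lemma sublinear_ge_uminus: "sublinear q \<Longrightarrow> - q (- x) \<le> q x"
  using sublinear_add[of q x "- x"] sublinear_zero[of q] by simp

text \<open>This is the greatest sublinear functional below \<open>q\<close> whose value at
  \<open>- y\<close> is at most \<open>- q y\<close>. A linear functional below it therefore takes
  the value \<open>q y\<close> at \<open>y\<close>.\<close>

definition tilt :: "('a::real_vector \<Rightarrow> real) \<Rightarrow> 'a \<Rightarrow> 'a \<Rightarrow> real" where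
  "tilt q y x = (INF t\<in>{0..}. q (x + t *\<^sub>R y) - t * q y)"

lemma tilt_le:
  assumes "sublinear q" "0 \<le> t"
  shows "tilt q y x \<le> q (x + t *\<^sub>R y) - t * q y"
  unfolding tilt_def
proof (rule cINF_lower)
  show "bdd_below ((\<lambda>t. q (x + t *\<^sub>R y) - t * q y) ` {0..})"
  proof (rule bdd_belowI2[where m = "- q (- x)"])
    fix s :: real assume "s \<in> {0..}"
    then show "- q (- x) \<le> q (x + s *\<^sub>R y) - s * q y"
      using sublinear_add[OF assms(1), of "x + s *\<^sub>R y" "- x"] sublinear_scale[OF assms(1), of s y]
      by simp
  qed
qed (use assms(2) in simp)

lemma tilt_greatest:
  assumes "\<And>t. 0 \<le> t \<Longrightarrow> m \<le> q (x + t *\<^sub>R y) - t * q y"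
  shows "m \<le> tilt q y x"
  unfolding tilt_def by (rule cINF_greatest) (use assms in auto)

text \<open>Parameters \<open>s\<close> for \<open>u\<close> and \<open>t\<close> for
  \<open>v\<close> combine to \<open>s + t\<close> for \<open>u + v\<close>, and the two infima are
  taken one after the other; scaling by \<open>c\<close> rescales the parameter to
  \<open>c * t\<close>.\<close>

lemma sublinear_tilt:
  assumes q: "sublinear q" shows "sublinear (tilt q y)"
  unfolding sublinear_def
proof (intro conjI allI impI)
  fix u v :: 'a
  have "tilt q y (u + v) - (q (u + s *\<^sub>R y) - s * q y) \<le> q (v + t *\<^sub>R y) - t * q y"
    if "0 \<le> s" "0 \<le> t" for s t
    using tilt_le[OF q, of "s + t" y "u + v"] sublinear_add[OF q, of "u + s *\<^sub>R y" "v + t *\<^sub>R y"] that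
    by (simp add: algebra_simps)
  then have "tilt q y (u + v) - tilt q y v \<le> q (u + s *\<^sub>R y) - s * q y" if "0 \<le> s" for s
    using tilt_greatest[of "tilt q y (u + v) - (q (u + s *\<^sub>R y) - s * q y)" q v y] that by force
  then have "tilt q y (u + v) - tilt q y v \<le> tilt q y u" by (rule tilt_greatest)
  then show "tilt q y (u + v) \<le> tilt q y u + tilt q y v" by simp
next
  fix c :: real and x :: 'a assume c: "0 \<le> c"
  show "tilt q y (c *\<^sub>R x) \<le> c * tilt q y x"
  proof (cases "c = 0")
    case True
    then show ?thesis using tilt_le[OF q, of 0 y 0] sublinear_zero[OF q] by simp
  next
    case False
    have "tilt q y (c *\<^sub>R x) / c \<le> q (x + t *\<^sub>R y) - t * q y" if "0 \<le> t" for t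
      using tilt_le[OF q, of "c * t" y "c *\<^sub>R x"] sublinear_scale[OF q c, of "x + t *\<^sub>R y"] that c False
      by (simp add: field_simps scaleR_add_right)
    then have "tilt q y (c *\<^sub>R x) / c \<le> tilt q y x" by (rule tilt_greatest)
    then show ?thesis using c False by (simp add: field_simps)
  qed
qed

text \<open>A minimal sublinear functional agrees with all its tilts, which forces additivity.\<close>

lemma minimal_sublinear_linear:
  assumes q: "sublinear q" and min: "\<And>r. sublinear r \<Longrightarrow> r \<le> q \<Longrightarrow> r = q"
  shows "linear q"
proof -
  have "tilt q y = q" for y
    by (rule min[OF sublinear_tilt[OF q]]) (use tilt_le[OF q, of 0 y] in \<open>simp add: le_fun_def\<close>)
  then have "q x + q y \<le> q (x + y)" for x y using tilt_le[OF q, of 1 y x] by simp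
  then have add: "q (x + y) = q x + q y" for x y by (meson sublinear_add[OF q] order_antisym)
  then have neg: "q (- x) = - q x" for x
    using sublinear_zero[OF q] by (metis add.inverse_unique add.right_inverse)
  show ?thesis
  proof (rule linearI[OF add])
    fix c x
    show "q (c *\<^sub>R x) = c *\<^sub>R q x"
    proof (cases "0 \<le> c")
      case False
      then show ?thesis using sublinear_scale[OF q, of "- c" x] neg[of "c *\<^sub>R x"] by simp
    qed (simp add: sublinear_scale[OF q])
  qed
qed

text \<open>A Hahn-Banach theorem: Zorn's lemma gives a minimal sublinear functional below
  \<open>p\<close>, and minimality makes it linear.\<close>

lemma linear_below_sublinear:
  assumes p: "sublinear p" obtains f where "linear f" "f \<le> p"
proof -
  define A where "A = {q. sublinear q \<and> q \<le> p}"
  have "\<exists>m\<in>A. \<forall>a\<in>A. a \<le> m \<longrightarrow> a = m"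
  \<comment> \<open>The order is reversed, so that maximal elements are minimal functionals and the
    upper bound of a chain is its pointwise infimum.\<close>
  proof (rule predicate_Zorn)
    show "partial_order_on A (relation_of (\<lambda>a b. b \<le> a) A)"
      by (rule partial_order_on_relation_ofI) auto
  next
    fix C assume "C \<in> Chains (relation_of (\<lambda>a b. b \<le> a) A)"
    then have sub: "C \<subseteq> A" and chain: "\<And>a b. a \<in> C \<Longrightarrow> b \<in> C \<Longrightarrow> a \<le> b \<or> b \<le> a"
      by (auto simp: Chains_def relation_of_def)
    show "\<exists>u\<in>A. \<forall>a\<in>C. u \<le> a"
    proof (cases "C = {}")
      case True
      then show ?thesis using p by (auto simp: A_def)
    next
      case False
      define u where "u x = (INF q\<in>C. q x)" for x
      have low: "u x \<le> q x" if "q \<in> C" for q x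
        unfolding u_def
      \<comment> \<open>The bound \<open>- p (- x)\<close> is common to all members of the chain, so
        the real infimum is meaningful.\<close>
      proof (rule cINF_lower[OF _ that], rule bdd_belowI2[where m = "- p (- x)"])
        fix r assume "r \<in> C"
        then have "sublinear r" "r (- x) \<le> p (- x)" using sub by (auto simp: A_def le_fun_def)
        then show "- p (- x) \<le> r x" using sublinear_ge_uminus[of r x] by linarith
      qed
      have great: "m \<le> u x" if "\<And>q. q \<in> C \<Longrightarrow> m \<le> q x" for m x
        unfolding u_def by (rule cINF_greatest[OF False that])
      have C: "sublinear r" if "r \<in> C" for r using sub that by (auto simp: A_def)
      have "sublinear u" unfolding sublinear_def
      proof (intro conjI allI impI)
        fix x y
        \<comment> \<open>Subadditivity of the smaller of \<open>q\<close> and \<open>r\<close>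
          gives the estimate; this is where the chain property enters.\<close>
        have "u (x + y) - q x \<le> r y" if "q \<in> C" "r \<in> C" for q r
        proof (cases "q \<le> r")
          case True
          then show ?thesis
            using low[OF that(1), of "x + y"] sublinear_add[OF C[OF that(1)], of x y] le_funD[OF True, of y]
            by linarith
        next
          case False
          then have "r x \<le> q x" using chain[OF that] by (auto simp: le_fun_def)
          then show ?thesis
            using low[OF that(2), of "x + y"] sublinear_add[OF C[OF that(2)], of x y] by linarith
        qed
        then have "u (x + y) - u y \<le> q x" if "q \<in> C" for q using great[of "u (x + y) - q x" y] that by force
        then have "u (x + y) - u y \<le> u x" by (rule great)
        then show "u (x + y) \<le> u x + u y" by simp
      next
        fix c :: real and x assume c: "0 \<le> c"
        show "u (c *\<^sub>R x) \<le> c * u x"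
        proof (cases "c = 0")
          case True
          obtain q where "q \<in> C" using False by blast
          then show ?thesis using low[of q 0] sublinear_zero[OF C, of q] True by simp
        next
          case c0: False
          have "u (c *\<^sub>R x) / c \<le> q x" if "q \<in> C" for q
            using low[OF that, of "c *\<^sub>R x"] sublinear_scale[OF C[OF that] c, of x] c c0
            by (simp add: field_simps)
          then have "u (c *\<^sub>R x) / c \<le> u x" by (rule great)
          then show ?thesis using c c0 by (simp add: field_simps)
        qed
      qed
      moreover have "u \<le> p"
      proof -
        obtain q where q: "q \<in> C" using False by blast
        then have "u \<le> q" using low by (simp add: le_fun_def)
        moreover have "q \<le> p" using q sub by (auto simp: A_def)
        ultimately show ?thesis by (rule order_trans)
      qed
      ultimately have "u \<in> A" by (simp add: A_def)
      moreover have "\<forall>a\<in>C. u \<le> a" using low by (simp add: le_fun_def)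
      ultimately show ?thesis by blast
    qed
  qed
  then obtain m where m: "sublinear m" "m \<le> p"
    and min: "\<And>a. sublinear a \<Longrightarrow> a \<le> p \<Longrightarrow> a \<le> m \<Longrightarrow> a = m"
    unfolding A_def by blast
  have "linear m"
  proof (rule minimal_sublinear_linear[OF m(1)])
    fix r assume r: "sublinear r" "r \<le> m"
    show "r = m" by (rule min[OF r(1) order_trans[OF r(2) m(2)] r(2)])
  qed
  then show ?thesis using m(2) by (rule that)
qed

text \<open>Take a linear functional below \<open>tilt N v\<close>: the parameter 0 bounds it by
  \<open>N\<close>, and the parameter 1 at \<open>- v\<close> forces the value \<open>N v\<close> at
  \<open>v\<close>.\<close>

lemma norming_functional:
  assumes N: "is_norm N"
  obtains f where "linear f" "\<And>x. f x \<le> N x" "f v = N v"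
proof -
  have s: "sublinear N" using N by (auto simp: sublinear_def is_norm_def)
  obtain f where f: "linear f" "f \<le> tilt N v"
    using linear_below_sublinear[OF sublinear_tilt[OF s]] by blast
  have le: "f x \<le> N x" for x
    using le_funD[OF f(2), of x] tilt_le[OF s, of 0 v x] by simp
  have "f (- v) \<le> - N v"
    using le_funD[OF f(2), of "- v"] tilt_le[OF s, of 1 v "- v"] sublinear_zero[OF s] by simp
  then have "f v = N v" using le[of v] linear_neg[OF f(1), of v] by simp
  then show ?thesis using that f(1) le by blast
qed

section \<open>Slices and Daugavet centers\<close>

lemma is_norm_add: "is_norm N \<Longrightarrow> N (v + w) \<le> N v + N w"
  by (simp add: is_norm_def)

lemma is_norm_scaleR: "is_norm N \<Longrightarrow> N (c *\<^sub>R v) = \<bar>c\<bar> * N v"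
  by (simp add: is_norm_def)

lemma is_norm_minus: "is_norm N \<Longrightarrow> N (- v) = N v"
  using is_norm_scaleR[of N "-1" v] by simp

lemma is_norm_eq_0_iff: "is_norm N \<Longrightarrow> N v = 0 \<longleftrightarrow> v = 0"
  by (simp add: is_norm_def)

section \<open>Operator norms with respect to an explicit norm function\<close>

lemma bdd_above_operator_norm:
  fixes T :: "'b::real_normed_vector \<Rightarrow> 'a::real_vector"
  assumes "bounded_operator N T" "is_norm N"
  shows "bdd_above (range (\<lambda>e. N (T e) / norm e))"
proof -
  obtain K where K: "\<And>e. N (T e) \<le> norm e * K" using assms(1) by (auto simp: bounded_operator_def)
  show ?thesis
  \<comment> \<open>The absolute value also covers \<open>e = 0\<close>, where the quotient is 0 by
    convention.\<close>
  proof (rule bdd_aboveI2[where M = "\<bar>K\<bar>"])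
    fix e :: 'b
    have "norm e * K \<le> norm e * \<bar>K\<bar>" by (intro mult_left_mono) auto
    then have "N (T e) \<le> norm e * \<bar>K\<bar>" using K[of e] by linarith
    then show "N (T e) / norm e \<le> \<bar>K\<bar>"
      by (cases "e = 0") (auto simp: field_simps)
  qed
qed

lemma operator_norm_bound:
  assumes "bounded_operator N T" "is_norm N"
  shows "N (T e) \<le> operator_norm N T * norm e"
proof (cases "e = 0")
  case True
  have "linear T" using assms(1) by (simp add: bounded_operator_def)
  then show ?thesis using True is_norm_eq_0_iff[OF assms(2), of 0] by (simp add: linear_0)
next
  case False
  have "N (T e) / norm e \<le> operator_norm N T"
    unfolding operator_norm_def by (rule cSUP_upper[OF _ bdd_above_operator_norm[OF assms]]) simp
  then show ?thesis using False by (simp add: field_simps)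
qed

lemma operator_norm_approx:
  assumes "bounded_operator N T" "is_norm N" "m < operator_norm N T" "0 \<le> m"
  obtains e where "norm e = 1" "m < N (T e)"
proof -
  have lin: "linear T" using assms(1) by (simp add: bounded_operator_def)
  obtain e where e: "m < N (T e) / norm e"
    using assms(3) less_cSUP_iff[OF _ bdd_above_operator_norm[OF assms(1,2)]]
    unfolding operator_norm_def by auto
  \<comment> \<open>The quotient at 0 is 0, which does not exceed the nonnegative
    \<open>m\<close>.\<close>
  then have "e \<noteq> 0" using assms(4) by auto
  moreover have "N (T (inverse (norm e) *\<^sub>R e)) = N (T e) / norm e"
    by (simp add: linear_scale[OF lin] is_norm_scaleR[OF assms(2)] divide_inverse mult.commute)
  ultimately show ?thesis using e that[of "inverse (norm e) *\<^sub>R e"] by simp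
qed

section \<open>Consequences of the Daugavet equation\<close>

lemma dim_range_rank_one:
  assumes "linear f" "f e \<noteq> (0::real)" "x \<noteq> 0"
  shows "dim (range (\<lambda>e. f e *\<^sub>R x)) = 1"
proof -
  have "c *\<^sub>R x \<in> range (\<lambda>e. f e *\<^sub>R x)" for c
    using assms by (intro range_eqI[where x = "(c / f e) *\<^sub>R e"]) (simp add: linear_scale)
  then have "range (\<lambda>e. f e *\<^sub>R x) = span {x}" by (auto simp: span_singleton)
  moreover have "dim (span {x}) = 1"
    using assms(3) by (subst dim_span_eq_card_independent) auto
  ultimately show ?thesis by simp
qed

lemma daugavet_center_norm_pos:
  assumes N: "is_norm N" and G: "daugavet_center N G"
  shows "0 < operator_norm N G"
proof -
  have Gb: "bounded_operator N G" using G by (simp add: daugavet_center_def)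
  obtain e where "G e \<noteq> 0" using G by (auto simp: daugavet_center_def)
  then have "0 < N (G e)"
    using is_norm_nonneg[OF N, of "G e"] is_norm_eq_0_iff[OF N, of "G e"] by simp
  then have "0 < operator_norm N G * norm e" using operator_norm_bound[OF Gb N, of e] by linarith
  then show ?thesis by (simp add: zero_less_mult_iff)
qed

text \<open>The rank-1 operator \<open>T\<close> built from the normalized \<open>h\<close> and
  \<open>x\<close> has the same norm as \<open>G\<close>, so \<open>G + T\<close> has norm twice
  that of \<open>G\<close>. A unit vector almost attaining it, up to sign, has \<open>h e\<close>
  almost maximal, hence \<open>T e\<close> close to \<open>x\<close>.\<close>

lemma daugavet_center_slice:
  fixes G :: "'e::banach \<Rightarrow> 'x::real_vector"
  assumes N: "is_norm N" and G: "daugavet_center N G" and x: "N x = operator_norm N G"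
    and h: "bounded_linear h" "0 < onorm h" and \<epsilon>: "0 < \<epsilon>" "\<epsilon> < 1"
  obtains e where "norm e = 1" "(1 - \<epsilon>) * onorm h < h e" "(2 - \<epsilon>) * operator_norm N G < N (G e + x)"
proof -
  define g where "g = operator_norm N G"
  have Gb: "bounded_operator N G" using G by (simp add: daugavet_center_def)
  have g: "0 < g" using daugavet_center_norm_pos[OF N G] by (simp add: g_def)
  define f where "f e = h e / onorm h" for e
  have fl: "linear f" unfolding f_def
    using h(1) by (auto intro!: linearI simp: linear_add linear_scale bounded_linear.linear add_divide_distrib)
  have fb: "\<bar>f e\<bar> \<le> norm e" for e
    using onorm[OF h(1), of e] h(2) by (simp add: f_def field_simps)
  define T where "T e = f e *\<^sub>R x" for e
  have NT: "N (T e) = \<bar>f e\<bar> * g" for e by (simp add: T_def is_norm_scaleR[OF N] x g_def)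
  have Tl: "linear T" unfolding T_def
    using fl by (auto intro!: linearI simp: linear_add linear_scale scaleR_add_left)
  have Tb: "bounded_operator N T" unfolding bounded_operator_def
    using Tl NT fb g by (auto intro!: exI[of _ g] mult_right_mono)
  have "x \<noteq> 0" using x g is_norm_eq_0_iff[OF N, of x] by (auto simp: g_def)
  moreover obtain e\<^sub>1 where e1: "f e\<^sub>1 \<noteq> 0"
    using h onorm_eq_0[OF h(1)] by (auto simp: f_def)
  ultimately have "dim (range T) = 1" unfolding T_def using dim_range_rank_one[OF fl] by blast
  with G Tb have eq: "operator_norm N (\<lambda>e. G e + T e) = g + operator_norm N T"
    by (simp add: daugavet_center_def g_def)
  \<comment> \<open>A smaller norm of \<open>T\<close> would bound \<open>h\<close> by less than
    \<open>onorm h\<close>.\<close>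
  have "g \<le> operator_norm N T"
  proof -
    have "norm (h e) \<le> (operator_norm N T / g * onorm h) * norm e" for e
      using operator_norm_bound[OF Tb N, of e] NT[of e] g h(2) by (simp add: f_def field_simps)
    moreover have "0 \<le> operator_norm N T / g * onorm h"
    proof -
      have "0 < operator_norm N T * norm e\<^sub>1"
        using operator_norm_bound[OF Tb N, of e\<^sub>1] NT[of e\<^sub>1] mult_pos_pos[of "\<bar>f e\<^sub>1\<bar>" g] e1 g
        by linarith
      then show ?thesis using g h(2) by (simp add: zero_less_mult_iff)
    qed
    ultimately have "onorm h \<le> operator_norm N T / g * onorm h" by (intro onorm_bound)
    then show ?thesis using g h(2) by (simp add: field_simps)
  qed
  \<comment> \<open>Half of the tolerance is spent here, the other half on replacing
    \<open>T e\<close> by \<open>x\<close>.\<close>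
  then have big: "(2 - \<epsilon> / 2) * g < operator_norm N (\<lambda>e. G e + T e)"
    using eq mult_pos_pos[OF g \<epsilon>(1)] by (simp add: algebra_simps)
  have GTb: "bounded_operator N (\<lambda>e. G e + T e)"
    unfolding bounded_operator_def
  proof (intro conjI exI allI)
    show "linear (\<lambda>e. G e + T e)"
      using Gb Tl by (intro linear_compose_add) (auto simp: bounded_operator_def)
    fix e show "N (G e + T e) \<le> norm e * (operator_norm N G + operator_norm N T)"
      using is_norm_add[OF N, of "G e" "T e"] operator_norm_bound[OF Gb N, of e] operator_norm_bound[OF Tb N, of e]
      by (simp add: algebra_simps)
  qed
  obtain e\<^sub>2 where e2: "norm e\<^sub>2 = 1" "(2 - \<epsilon> / 2) * g < N (G e\<^sub>2 + T e\<^sub>2)"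
    using operator_norm_approx[OF GTb N big] g \<epsilon> by auto
  \<comment> \<open>The sign is chosen so that \<open>f e\<close> is nonnegative; the norm of
    \<open>G e + T e\<close> does not change.\<close>
  define e where "e = (if 0 \<le> f e\<^sub>2 then e\<^sub>2 else - e\<^sub>2)"
  have Gl: "linear G" using Gb by (simp add: bounded_operator_def)
  have "G (- e\<^sub>2) + T (- e\<^sub>2) = - (G e\<^sub>2 + T e\<^sub>2)" by (simp add: linear_neg[OF Gl] linear_neg[OF Tl])
  then have e: "norm e = 1" "0 \<le> f e" "(2 - \<epsilon> / 2) * g < N (G e + T e)"
    using e2 is_norm_minus[OF N, of "G e\<^sub>2 + T e\<^sub>2"] by (auto simp: e_def linear_neg[OF fl])
  have fe: "f e \<le> 1" using fb[of e] e by simp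
  have "N (G e + T e) \<le> g + f e * g"
    using is_norm_add[OF N, of "G e" "T e"] operator_norm_bound[OF Gb N, of e] NT[of e] e
    by (simp add: g_def)
  then have "(1 - \<epsilon> / 2) * g < f e * g" using e(3) by (simp add: algebra_simps)
  then have f1: "1 - \<epsilon> / 2 < f e" using g by simp
  have "N (G e + T e) \<le> N (G e + x) + (1 - f e) * g"
    using is_norm_add[OF N, of "G e + x" "(f e - 1) *\<^sub>R x"] is_norm_scaleR[OF N, of "f e - 1" x] fe x
    by (simp add: T_def g_def algebra_simps)
  moreover have "(1 - f e) * g < \<epsilon> / 2 * g" using f1 g by simp
  ultimately have "(2 - \<epsilon>) * g < N (G e + x)" using e(3) by (simp add: algebra_simps)
  moreover have "(1 - \<epsilon>) * onorm h < h e"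
  proof -
    have "1 - \<epsilon> < f e" using f1 \<epsilon> by simp
    then show ?thesis using h(2) by (simp add: f_def field_simps)
  qed
  ultimately show ?thesis using that e(1) by (simp add: g_def)
qed

text \<open>The estimate for \<open>x\<close> is turned into membership in a slice. The second
  application chooses its vector inside that slice, so the estimate for \<open>x\<close> survives
  while the one for \<open>x'\<close> is gained.\<close>

lemma daugavet_center_two_points:
  fixes G :: "'e::banach \<Rightarrow> 'x::real_vector"
  assumes N: "is_norm N" and G: "daugavet_center N G" and x: "N x = 1" "N x' = 1" and \<epsilon>: "0 < \<epsilon>"
  obtains y where "N y \<le> 1" "2 - \<epsilon> < N (y + x)" "2 - \<epsilon> < N (y + x')"
proof -
  define g where "g = operator_norm N G"
  \<comment> \<open>The estimate for \<open>x\<close> loses \<open>3 * d\<close>: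
    \<open>2 * d\<close> through \<open>(1 - d) * (1 - d)\<close> for the nested slices, and
    \<open>d\<close> for the value of \<open>\<phi>\<close> at \<open>g *\<^sub>R x\<close>.\<close>
  define d where "d = min (\<epsilon> / 3) (1 / 2)"
  have d: "0 < d" "d < 1" "3 * d \<le> \<epsilon>" using \<epsilon> by (auto simp: d_def)
  have Gb: "bounded_operator N G" using G by (simp add: daugavet_center_def)
  then have Gl: "linear G" by (simp add: bounded_operator_def)
  have g: "0 < g" using daugavet_center_norm_pos[OF N G] by (simp add: g_def)
  obtain e\<^sub>0 where "G e\<^sub>0 \<noteq> 0" using G by (auto simp: daugavet_center_def)
  then have "0 < N (G e\<^sub>0)"
    using is_norm_nonneg[OF N, of "G e\<^sub>0"] is_norm_eq_0_iff[OF N, of "G e\<^sub>0"] by simp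
  have gx: "N (g *\<^sub>R x) = operator_norm N G" "N (g *\<^sub>R x') = operator_norm N G"
    using g x by (simp_all add: is_norm_scaleR[OF N] g_def)
  have pull: "bounded_linear (\<lambda>e. \<phi> (G e))"
    if "linear \<phi>" "\<And>v. \<phi> v \<le> N v" for \<phi> :: "'x \<Rightarrow> real"
  proof -
    have "\<bar>\<phi> v\<bar> \<le> N v" for v
      using that(2)[of v] that(2)[of "- v"] is_norm_minus[OF N] linear_neg[OF that(1)] by (simp add: abs_le_iff)
    then have "norm (\<phi> (G e)) \<le> norm e * g" for e
      using operator_norm_bound[OF Gb N, of e] order_trans by (fastforce simp: g_def mult.commute)
    then show ?thesis
      using linear_compose[OF Gl that(1)]
      by (auto simp: bounded_linear_def bounded_linear_axioms_def o_def)
  qed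
  \<comment> \<open>The first application needs some functional of positive norm on the domain;
    \<open>\<psi>\<close> norms the nonzero vector \<open>G e\<^sub>0\<close>, so its composition
    with \<open>G\<close> is one.\<close>
  obtain \<psi> where \<psi>: "linear \<psi>" "\<And>v. \<psi> v \<le> N v" "\<psi> (G e\<^sub>0) = N (G e\<^sub>0)"
    using norming_functional[OF N, of "G e\<^sub>0"] by blast
  have \<psi>b: "bounded_linear (\<lambda>e. \<psi> (G e))" by (rule pull[OF \<psi>(1,2)])
  have "0 < onorm (\<lambda>e. \<psi> (G e)) * norm e\<^sub>0"
    using onorm[OF \<psi>b, of e\<^sub>0] \<psi>(3) \<open>0 < N (G e\<^sub>0)\<close> by simp
  then have "0 < onorm (\<lambda>e. \<psi> (G e))" by (simp add: zero_less_mult_iff)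
  then obtain e\<^sub>1 where e1: "norm e\<^sub>1 = 1" "(1 - d) * onorm (\<lambda>e. \<psi> (G e)) < \<psi> (G e\<^sub>1)"
    "(2 - d) * g < N (G e\<^sub>1 + g *\<^sub>R x)"
    by (rule daugavet_center_slice[OF N G gx(1) \<psi>b _ d(1,2), folded g_def])
  obtain \<phi> where \<phi>: "linear \<phi>" "\<And>v. \<phi> v \<le> N v" "\<phi> (G e\<^sub>1 + g *\<^sub>R x) = N (G e\<^sub>1 + g *\<^sub>R x)"
    using norming_functional[OF N, of "G e\<^sub>1 + g *\<^sub>R x"] by blast
  define h where "h e = \<phi> (G e)" for e
  have hb: "bounded_linear h" unfolding h_def by (rule pull[OF \<phi>(1,2)])
  have sum: "\<phi> (G e + g *\<^sub>R x) = h e + \<phi> (g *\<^sub>R x)" for e by (simp add: h_def linear_add[OF \<phi>(1)])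
  have "\<phi> (g *\<^sub>R x) \<le> g" "h e\<^sub>1 \<le> g"
    using \<phi>(2)[of "g *\<^sub>R x"] \<phi>(2)[of "G e\<^sub>1"] operator_norm_bound[OF Gb N, of e\<^sub>1] gx e1
    by (auto simp: h_def g_def)
  \<comment> \<open>Two numbers of size at most \<open>g\<close> whose sum exceeds
    \<open>(2 - d) * g\<close> both exceed \<open>(1 - d) * g\<close>.\<close>
  then have lower: "(1 - d) * g < \<phi> (g *\<^sub>R x)" "(1 - d) * g < h e\<^sub>1"
    using e1(3) sum[of e\<^sub>1] \<phi>(3) by (auto simp: algebra_simps)
  then have on: "(1 - d) * g < onorm h" using onorm[OF hb, of e\<^sub>1] e1(1) by simp
  then have "0 < onorm h" using mult_pos_pos[of "1 - d" g] g d by linarith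
  then obtain e where e: "norm e = 1" "(1 - d) * onorm h < h e" "(2 - d) * g < N (G e + g *\<^sub>R x')"
    by (rule daugavet_center_slice[OF N G gx(2) hb _ d(1,2), folded g_def])
  have "(1 - d) * ((1 - d) * g) < h e"
    using e(2) on d by (meson less_trans mult_strict_left_mono diff_gt_0_iff_gt)
  moreover have "(1 - d) * ((1 - d) * g) = (1 - 2 * d) * g + d * d * g" by (simp add: algebra_simps)
  moreover have "0 \<le> d * d * g" using g by simp
  ultimately have "(2 - 3 * d) * g < \<phi> (G e + g *\<^sub>R x)"
    using lower(1) sum[of e] by (simp add: algebra_simps)
  then have e': "(2 - 3 * d) * g < N (G e + g *\<^sub>R x)" using \<phi>(2) by (meson less_le_trans)
  define y where "y = inverse g *\<^sub>R G e"
  have scaled: "N (y + v) = N (G e + g *\<^sub>R v) / g" for v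
  proof -
    have "y + v = inverse g *\<^sub>R (G e + g *\<^sub>R v)" using g by (simp add: y_def scaleR_add_right)
    then show ?thesis using g by (simp add: is_norm_scaleR[OF N] divide_inverse mult.commute)
  qed
  show ?thesis
  proof (rule that)
    show "N y \<le> 1"
      using scaled[of 0] operator_norm_bound[OF Gb N, of e] e g by (simp add: g_def)
    have "2 - 3 * d < N (y + x)" unfolding scaled using e' g by (simp add: pos_less_divide_eq)
    then show "2 - \<epsilon> < N (y + x)" using d by simp
    have "2 - d < N (y + x')" unfolding scaled using e(3) g by (simp add: pos_less_divide_eq)
    then show "2 - \<epsilon> < N (y + x')" using d by simp
  qed
qed

section \<open>The positive arc of a two-dimensional lattice\<close>

text \<open>The point \<open>w\<close> and its mirror image \<open>w'\<close> on the segment add up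
  to \<open>u + v\<close>. Each has norm at most 1 and the sum has norm 2, so both norms are
  1.\<close>

lemma sphere_segment:
  assumes N: "is_norm N" and "N u = 1" "N v = 1" "N (u + v) = 2" and w: "w \<in> closed_segment u v"
  shows "N w = 1"
proof -
  obtain t where t: "0 \<le> t" "t \<le> 1" "w = (1 - t) *\<^sub>R u + t *\<^sub>R v"
    using w by (auto simp: closed_segment_def)
  define w' where "w' = t *\<^sub>R u + (1 - t) *\<^sub>R v"
  have "u + v = w + w'" by (simp add: t w'_def algebra_simps)
  then have "2 \<le> N w + N w'" using is_norm_add[OF N, of w w'] assms(4) by simp
  moreover have "N w \<le> 1" "N w' \<le> 1"
    using is_norm_add[OF N, of "(1 - t) *\<^sub>R u" "t *\<^sub>R v"] is_norm_add[OF N, of "t *\<^sub>R u" "(1 - t) *\<^sub>R v"]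
      t assms(2,3) by (auto simp: is_norm_scaleR[OF N] w'_def)
  ultimately show ?thesis by simp
qed

text \<open>Dividing \<open>w\<close> by the sum of its coefficients gives a point of the segment,
  which has norm 1; since \<open>w\<close> has norm 1 too, that sum is 1.\<close>

lemma cone_sphere_segment:
  assumes N: "is_norm N" and uv: "N u = 1" "N v = 1" "N (u + v) = 2"
    and w: "w = \<alpha> *\<^sub>R u + \<beta> *\<^sub>R v" "0 \<le> \<alpha>" "0 \<le> \<beta>" "N w = 1"
  shows "w \<in> closed_segment u v"
proof -
  have "\<alpha> + \<beta> \<noteq> 0"
  proof
    assume "\<alpha> + \<beta> = 0"
    then have "\<alpha> = 0" "\<beta> = 0" using w by auto
    then show False using w is_norm_eq_0_iff[OF N, of w] by simp
  qed
  then have s: "0 < \<alpha> + \<beta>" using w by simp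
  define z where "z = inverse (\<alpha> + \<beta>) *\<^sub>R w"
  have "z = (1 - \<beta> / (\<alpha> + \<beta>)) *\<^sub>R u + (\<beta> / (\<alpha> + \<beta>)) *\<^sub>R v"
  proof -
    have "1 - \<beta> / (\<alpha> + \<beta>) = inverse (\<alpha> + \<beta>) * \<alpha>" using s by (simp add: field_simps)
    then show ?thesis by (simp add: z_def w(1) scaleR_add_right divide_inverse mult.commute)
  qed
  moreover have "0 \<le> \<beta> / (\<alpha> + \<beta>)" "\<beta> / (\<alpha> + \<beta>) \<le> 1" using w s by auto
  ultimately have z: "z \<in> closed_segment u v" by (auto simp: closed_segment_def)
  have "N z = inverse (\<alpha> + \<beta>)" using s w(4) by (simp add: z_def is_norm_scaleR[OF N])
  then have "\<alpha> + \<beta> = 1" using sphere_segment[OF N uv z] by simp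
  then show ?thesis using z by (simp add: z_def)
qed

section \<open>Passage from the sum space to the plane\<close>

lemma continuous_on_two_dim_lattice:
  assumes "two_dim_lattice F" shows "continuous_on UNIV F"
proof (rule convex_on_continuous)
  have N: "is_norm F" using assms by (simp add: two_dim_lattice_def)
  show "convex_on UNIV F"
  proof (rule convex_onI)
    fix t :: real and x y :: "real \<times> real" assume "0 < t" "t < 1"
    then show "F ((1 - t) *\<^sub>R x + t *\<^sub>R y) \<le> (1 - t) * F x + t * F y"
      using is_norm_add[OF N, of "(1 - t) *\<^sub>R x" "t *\<^sub>R y"] by (simp add: is_norm_scaleR[OF N])
  qed simp
qed simp

text \<open>Replacing a vector by the pair of norms of its components keeps the two estimates,
  because \<open>F\<close> is monotone on the positive quadrant. The remaining problem is planar,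
  where compactness removes the tolerance.\<close>

lemma daugavet_range_corner:
  assumes F: "two_dim_lattice F"
    and ne: "\<exists>x::'x\<^sub>1::banach. x \<noteq> 0" "\<exists>x::'x\<^sub>2::banach. x \<noteq> 0"
    and D: "daugavet_range TYPE('e::banach) (lattice_sum_norm F :: 'x\<^sub>1 \<times> 'x\<^sub>2 \<Rightarrow> real)"
  obtains c where "c \<in> pos_sphere F" "F ((1, 0) + c) = 2" "F (c + (0, 1)) = 2"
proof -
  have N: "is_norm F" using F by (simp add: two_dim_lattice_def)
  have F1: "F (1, 0) = 1" "F (0, 1) = 1" using F by (auto simp: two_dim_lattice_def)
  let ?L = "lattice_sum_norm F :: 'x\<^sub>1 \<times> 'x\<^sub>2 \<Rightarrow> real"
  obtain G :: "'e \<Rightarrow> 'x\<^sub>1 \<times> 'x\<^sub>2" where G: "daugavet_center ?L G" using D by (auto simp: daugavet_range_def)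
  obtain z\<^sub>1 :: 'x\<^sub>1 and z\<^sub>2 :: 'x\<^sub>2 where z: "z\<^sub>1 \<noteq> 0" "z\<^sub>2 \<noteq> 0" using ne by blast
  define x\<^sub>1 where "x\<^sub>1 = sgn z\<^sub>1"
  define x\<^sub>2 where "x\<^sub>2 = sgn z\<^sub>2"
  have x: "norm x\<^sub>1 = 1" "norm x\<^sub>2 = 1" using z by (simp_all add: x\<^sub>1_def x\<^sub>2_def norm_sgn)
  define K where "K = cbox (0, 0) (1, 1) \<inter> {a. F a \<le> 1}"
  \<comment> \<open>Maximizing the minimum yields one point that serves both conditions at
    once.\<close>
  define \<Phi> where "\<Phi> a = min (F ((1, 0) + a)) (F (a + (0, 1)))" for a
  have cont: "continuous_on S (\<lambda>a. F (f a))" if "continuous_on S f" for S f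
    using continuous_on_compose2[OF continuous_on_two_dim_lattice[OF F] that] by simp
  have "closed {a. F a \<le> 1}"
    by (intro closed_Collect_le cont continuous_intros continuous_on_id)
  then have "compact K" unfolding K_def by (intro compact_Int_closed compact_cbox)
  moreover have "(1, 0) \<in> K" using F1 by (simp add: K_def cbox_Pair_eq)
  then have "K \<noteq> {}" by blast
  moreover have "continuous_on K \<Phi>" unfolding \<Phi>_def by (intro continuous_intros cont)
  ultimately obtain c where c: "c \<in> K" "\<And>a. a \<in> K \<Longrightarrow> \<Phi> a \<le> \<Phi> c"
    using continuous_attains_sup by metis
  have "2 - \<epsilon> \<le> \<Phi> c" if \<epsilon>: "0 < \<epsilon>" for \<epsilon>
  proof -
    have "?L (x\<^sub>1, 0) = 1" "?L (0, x\<^sub>2) = 1" using x F1 by (simp_all add: lattice_sum_norm_def)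
    then obtain y where y: "?L y \<le> 1" "2 - \<epsilon> < ?L (y + (x\<^sub>1, 0))" "2 - \<epsilon> < ?L (y + (0, x\<^sub>2))"
      by (rule daugavet_center_two_points[OF is_norm_lattice_sum_norm[OF F] G _ _ \<epsilon>])
    define a where "a = (norm (fst y), norm (snd y))"
    have "a \<in> K"
      using y(1) lattice_sum_norm_bounds(1,2)[OF F, of y]
      by (auto simp: K_def a_def lattice_sum_norm_def cbox_Pair_eq)
    moreover have "?L (y + (x\<^sub>1, 0)) \<le> F ((1, 0) + a)" "?L (y + (0, x\<^sub>2)) \<le> F (a + (0, 1))"
      using norm_triangle_ineq[of "fst y" x\<^sub>1] norm_triangle_ineq[of "snd y" x\<^sub>2] x
      by (auto simp: lattice_sum_norm_def a_def add.commute intro!: two_dim_lattice_mono[OF F])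
    ultimately have "2 - \<epsilon> \<le> \<Phi> a" "\<Phi> a \<le> \<Phi> c" using y(2,3) c(2)[of a] by (auto simp: \<Phi>_def)
    then show ?thesis by linarith
  qed
  then have "2 \<le> \<Phi> c" by (metis add.commute diff_le_eq field_le_epsilon)
  then have ge: "2 \<le> F ((1, 0) + c)" "2 \<le> F (c + (0, 1))" by (auto simp: \<Phi>_def)
  have Fc: "F c \<le> 1" "0 \<le> fst c" "0 \<le> snd c"
    using c(1) by (cases c; auto simp: K_def cbox_Pair_eq)+
  \<comment> \<open>Against the lower bound 2 this forces \<open>F c = 1\<close> and equality in
    both conditions.\<close>
  have "F ((1, 0) + c) \<le> 1 + F c" "F (c + (0, 1)) \<le> F c + 1"
    using is_norm_add[OF N, of "(1, 0)" c] is_norm_add[OF N, of c "(0, 1)"] F1 by auto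
  then show ?thesis using ge Fc by (intro that[of c]) (auto simp: pos_sphere_def)
qed

text \<open>The ray through \<open>c\<close> cuts the positive quadrant into two cones, and in each
  of them the unit sphere is the segment between the unit vectors spanning it.\<close>

lemma pos_sphere_two_segments:
  assumes F: "two_dim_lattice F" and c: "c \<in> pos_sphere F" "F ((1, 0) + c) = 2" "F (c + (0, 1)) = 2"
  shows "pos_sphere F = closed_segment (1, 0) c \<union> closed_segment c (0, 1)"
proof
  have N: "is_norm F" using F by (simp add: two_dim_lattice_def)
  have F1: "F (1, 0) = 1" "F (0, 1) = 1" using F by (auto simp: two_dim_lattice_def)
  obtain c1 c2 where c12: "c = (c1, c2)" by force
  have Fc: "F c = 1" "0 \<le> c1" "0 \<le> c2" using c(1) by (auto simp: pos_sphere_def c12)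
  show "closed_segment (1, 0) c \<union> closed_segment c (0, 1) \<subseteq> pos_sphere F"
  proof
    fix a assume a: "a \<in> closed_segment (1, 0) c \<union> closed_segment c (0, 1)"
    then have "F a = 1" using sphere_segment[OF N] F1 Fc c by blast
    moreover have "0 \<le> fst a" "0 \<le> snd a" using a Fc by (auto simp: closed_segment_def c12)
    ultimately show "a \<in> pos_sphere F" by (simp add: pos_sphere_def)
  qed
  show "pos_sphere F \<subseteq> closed_segment (1, 0) c \<union> closed_segment c (0, 1)"
  proof
    fix a assume "a \<in> pos_sphere F"
    then obtain a1 a2 where a: "a = (a1, a2)" "F a = 1" "0 \<le> a1" "0 \<le> a2"
      by (cases a) (auto simp: pos_sphere_def)
    show "a \<in> closed_segment (1, 0) c \<union> closed_segment c (0, 1)"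
    \<comment> \<open>The sign of a determinant decides on which side of the ray \<open>a\<close>
      lies. If \<open>c2 = 0\<close>, the first cone degenerates and the second is the whole
      quadrant.\<close>
    proof (cases "a2 * c1 \<le> a1 * c2 \<and> 0 < c2")
      case True
      have "a \<in> closed_segment (1, 0) c"
        by (rule cone_sphere_segment[OF N F1(1) Fc(1) c(2), where \<alpha> = "a1 - a2 / c2 * c1" and \<beta> = "a2 / c2"])
          (use True a in \<open>auto simp: c12 field_simps\<close>)
      then show ?thesis by simp
    next
      case False
      have le: "a1 * c2 \<le> a2 * c1" using False Fc a by (cases "c2 = 0") auto
      have "c1 \<noteq> 0"
      proof
        assume c1: "c1 = 0"
        then have "c2 \<noteq> 0" using Fc(1) is_norm_eq_0_iff[OF N, of c] by (auto simp: c12 zero_prod_def)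
        then show False using False Fc(3) a(3) c1 by simp
      qed
      then have c1: "0 < c1" using Fc(2) by simp
      have "a \<in> closed_segment c (0, 1)"
        by (rule cone_sphere_segment[OF N Fc(1) F1(2) c(3), where \<alpha> = "a1 / c1" and \<beta> = "a2 - a1 / c1 * c2"])
          (use c1 le a in \<open>auto simp: c12 field_simps\<close>)
      then show ?thesis by simp
    qed
  qed
qed

section \<open>Edges of one segment and of two adjoining segments\<close>

lemma edges_segment:
  assumes "a \<noteq> b" shows "edges (closed_segment a b) = {closed_segment a b}"
proof
  show "{closed_segment a b} \<subseteq> edges (closed_segment a b)"
    unfolding edges_def using assms by (intro subsetI CollectI conjI) blast+
  show "edges (closed_segment a b) \<subseteq> {closed_segment a b}" unfolding edges_def by blast
qed

lemma linear_on_segment_inj: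
  assumes l: "linear (l :: _ \<Rightarrow> real)" "l c \<noteq> l q" and "x \<in> closed_segment c q" "l x = l c"
  shows "x = c"
proof -
  obtain t where t: "x = (1 - t) *\<^sub>R c + t *\<^sub>R q" using assms(3) by (auto simp: closed_segment_def)
  then have "l x = (1 - t) * l c + t * l q" by (simp add: linear_add[OF l(1)] linear_scale[OF l(1)])
  then have "t * (l q - l c) = 0" using assms(4) by (auto simp: algebra_simps)
  then have "t = 0" using l(2) by simp
  then show ?thesis using t by simp
qed

lemma linear_on_segment_const:
  assumes l: "linear (l :: _ \<Rightarrow> real)" "l p = l c" and "x \<in> closed_segment p c"
  shows "l x = l c"
proof -
  obtain t where "x = (1 - t) *\<^sub>R p + t *\<^sub>R c" using assms(3) by (auto simp: closed_segment_def)
  then have "l x = (1 - t) * l p + t * l c" by (simp add: linear_add[OF l(1)] linear_scale[OF l(1)])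
  then show ?thesis using l(2) by (simp add: algebra_simps)
qed

text \<open>The linear forms \<open>l\<close> and \<open>l'\<close> express that \<open>p\<close>, \<open>c\<close>, \<open>q\<close> are not collinear.\<close>

lemma segment_in_two_segments:
  assumes l: "linear (l :: _ \<Rightarrow> real)" "l p = l c" "l c \<noteq> l q"
    and l': "linear (l' :: _ \<Rightarrow> real)" "l' c = l' q" "l' p \<noteq> l' c"
    and sub: "closed_segment a b \<subseteq> closed_segment p c \<union> closed_segment c q"
  shows "closed_segment a b \<subseteq> closed_segment p c \<or> closed_segment a b \<subseteq> closed_segment c q"
proof (rule ccontr)
  assume "\<not> ?thesis"
  then obtain x y where xy: "x \<in> closed_segment a b" "y \<in> closed_segment a b"
    "x \<notin> closed_segment p c" "y \<notin> closed_segment c q" by blast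
  then have x: "x \<in> closed_segment c q" and y: "y \<in> closed_segment p c" using sub by blast+
  \<comment> \<open>The midpoint lies in one of the two segments together with \<open>x\<close> or
    \<open>y\<close>. The form constant along that segment then agrees with its value at
    \<open>c\<close> at the other point as well, which must be \<open>c\<close>.\<close>
  define m where "m = midpoint x y"
  have mid: "k m = (k x + k y) / 2" if "linear (k :: _ \<Rightarrow> real)" for k
    by (simp add: m_def midpoint_def linear_scale[OF that] linear_add[OF that])
  have "m \<in> closed_segment a b"
    using xy(1,2) midpoint_in_closed_segment[of x y] subset_closed_segment[of x y a b] unfolding m_def by blast
  then consider "m \<in> closed_segment p c" | "m \<in> closed_segment c q" using sub by blast
  then show False
  proof cases
    case 1
    then have "l m = l c" "l y = l c" using linear_on_segment_const[OF l(1,2)] y by blast+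
    then have "l x = l c" using mid[OF l(1)] by simp
    then have "x = c" using linear_on_segment_inj[OF l(1,3) x] by blast
    then show False using xy(3) by simp
  next
    case 2
    have l'': "l' q = l' c" "l' c \<noteq> l' p" using l' by auto
    have "l' m = l' c" "l' x = l' c"
      using linear_on_segment_const[OF l'(1) l''(1), unfolded closed_segment_commute[of q c]] 2 x
      by blast+
    then have "l' y = l' c" using mid[OF l'(1)] by simp
    then have "y = c"
      using linear_on_segment_inj[OF l'(1) l''(2), unfolded closed_segment_commute[of c p]] y by blast
    then show False using xy(4) by simp
  qed
qed

text \<open>Every segment in the union lies in one of the two, so only these can be maximal; both
  are, since \<open>p\<close> and \<open>q\<close> each lie in just one of them.\<close>

lemma edges_two_segments:
  assumes l: "linear (l :: _ \<Rightarrow> real)" "l p = l c" "l c \<noteq> l q"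
    and l': "linear (l' :: _ \<Rightarrow> real)" "l' c = l' q" "l' p \<noteq> l' c"
  shows "edges (closed_segment p c \<union> closed_segment c q) = {closed_segment p c, closed_segment c q}"
    (is "edges (?A \<union> ?B) = _")
proof
  note sub = segment_in_two_segments[OF l l']
  have "p \<notin> ?B" using linear_on_segment_const[OF l'(1), of q c p] l' by (auto simp: closed_segment_commute)
  moreover have "q \<notin> ?A" using linear_on_segment_const[OF l(1,2), of q] l by auto
  ultimately have "\<not> ?A \<subseteq> ?B" "\<not> ?B \<subseteq> ?A" by auto
  moreover have "p \<noteq> c" "c \<noteq> q" using l l' by auto
  ultimately show "{?A, ?B} \<subseteq> edges (?A \<union> ?B)"
    unfolding edges_def using sub by (intro subsetI CollectI conjI) (blast+)
  show "edges (?A \<union> ?B) \<subseteq> {?A, ?B}"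
  proof
    fix e assume "e \<in> edges (?A \<union> ?B)"
    note edge = this[unfolded edges_def mem_Collect_eq]
    note e = conjunct1[OF edge] conjunct1[OF conjunct2[OF edge]]
    note max = conjunct2[OF conjunct2[OF edge], rule_format, OF conjI]
    obtain a b where "e = closed_segment a b" using e(1) by blast
    then have "e \<subseteq> ?A \<or> e \<subseteq> ?B" using sub e(2) by simp
    then have "?A = e \<or> ?B = e" using max[OF _ Un_upper1] max[OF _ Un_upper2] by blast
    then show "e \<in> {?A, ?B}" by blast
  qed
qed

lemma two_segments_in_N2:
  assumes F: "two_dim_lattice F" and c: "0 \<le> fst c" "0 \<le> snd c"
    and S: "pos_sphere F = closed_segment (1, 0) c \<union> closed_segment c (0, 1)"
  shows "F \<in> \<NN>\<^sub>2"
\<comment> \<open>This is collinearity of \<open>c\<close> with the two unit vectors, where the arc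
  is a single edge.\<close>
proof (cases "fst c + snd c = 1")
  case True
  then have "c = (1 - snd c) *\<^sub>R (1, 0) + snd c *\<^sub>R (0, 1)" "snd c \<le> 1" using c by (cases c; simp)+
  then have "c \<in> closed_segment (1, 0) (0, 1)" using c by (auto simp: closed_segment_def)
  then have "pos_sphere F = closed_segment (1, 0) (0, 1)" using S Un_closed_segment by blast
  then show ?thesis using F by (simp add: \<NN>\<^sub>2_def edges_segment)
next
  case False
  \<comment> \<open>The forms \<open>l\<close> and \<open>l'\<close> are determinants vanishing on
    the directions \<open>c - (1, 0)\<close> and \<open>c - (0, 1)\<close>, hence constant along the
    respective segments.\<close>
  define l where "l x = snd x * (fst c - 1) - fst x * snd c" for x :: "real \<times> real"
  define l' where "l' x = fst x * (snd c - 1) - snd x * fst c" for x :: "real \<times> real"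
  have "edges (pos_sphere F) = {closed_segment (1, 0) c, closed_segment c (0, 1)}"
    unfolding S
  proof (rule edges_two_segments[where l = l and l' = l'])
    show "linear l" "linear l'" by (auto intro!: linearI simp: l_def l'_def algebra_simps)
  qed (use False in \<open>auto simp: l_def l'_def algebra_simps\<close>)
  then show ?thesis using F S by (simp add: \<NN>\<^sub>2_def card_insert_if)
qed

theorem corollary4p6:
  fixes F :: "real \<times> real \<Rightarrow> real"
  assumes "two_dim_lattice F" and "F \<notin> \<NN>\<^sub>2"
    and "\<exists>x::'x\<^sub>1::banach. x \<noteq> 0" and "\<exists>x::'x\<^sub>2::banach. x \<noteq> 0"
  shows "\<not> daugavet_range TYPE('e::banach) (lattice_sum_norm F :: 'x\<^sub>1 \<times> 'x\<^sub>2 \<Rightarrow> real)"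
proof
  assume "daugavet_range TYPE('e) (lattice_sum_norm F :: 'x\<^sub>1 \<times> 'x\<^sub>2 \<Rightarrow> real)"
  then obtain c where c: "c \<in> pos_sphere F" "F ((1, 0) + c) = 2" "F (c + (0, 1)) = 2"
    by (rule daugavet_range_corner[OF assms(1,3,4)])
  have "F \<in> \<NN>\<^sub>2"
    using two_segments_in_N2[OF assms(1) _ _ pos_sphere_two_segments[OF assms(1) c]] c(1)
    by (simp add: pos_sphere_def)
  then show False using assms(2) by contradiction
qed

end
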